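(* Let $f\colon \mathbb{R}^n_{>0}\to\mathbb{R}$ be a signomial. If there exists an $n$-simplex $P\subseteq\mathbb{R}^n$ such that $\sigma_-(f)\subseteq P$ and $\sigma_+(f)\subseteq P^-$, then $f^{-1}(\mathbb{R}_{<0})$ is either empty or contractible. In particular, $V_{>0}^c(f)$ has at most one negative connected component.
   Context: A signomial is a function $f\colon \mathbb{R}^n_{>0}\to\mathbb{R}$, $f(x)=\sum_{\mu\in\sigma(f)}c_\mu x^\mu$, where the support $\sigma(f)\subseteq\mathbb{R}^n$ is a finite set (real exponents allowed), $c_\mu\in\mathbb{R}\setminus\{0\}$, and $x^\mu=x_1^{\mu_1}\cdots x_n^{\mu_n}$. Put $\sigma_+(f)=\{\mu\in\sigma(f)\mid c_\mu>0\}$ and $\sigma_-(f)=\{\mu\in\sigma(f)\mid c_\mu<0\}$. $V_{>0}^c(f)=\{x\in\mathbb{R}^n_{>0}\mid f(x)\neq 0\}$; a connected component of it is negative if $f<0$ on it. For an $n$-simplex $P\subseteq\mathbb{R}^n$ with vertices $\mu_0,\dots,\mu_n$, the negative vertex cone at $\mu_k$ ($k=0,\dots,n$) is $$P^{-,k}=\Big\{\sum_{i=0}^n\lambda_i\mu_i \;\Big|\; \sum_{i=0}^n\lambda_i=1,\ \lambda_i\leq 0\text{ for all } i\neq k\Big\},$$ and $P^-=\bigcup_{k=0}^n P^{-,k}$. *)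

theory Defs imports "HOL-Analysis.Analysis" begin

definition pos_orthant :: "(real ^ 'n) set" where
  "pos_orthant = {x. \<forall>i. 0 < x $ i}"

definition monomial :: "real ^ 'n \<Rightarrow> real ^ 'n \<Rightarrow> real" where
  "monomial \<mu> x = (\<Prod>i\<in>UNIV. x $ i powr \<mu> $ i)"

text \<open>\<open>signomial S c f\<close>: the function \<open>f\<close> is, on the positive orthant, the signomial with support
  \<open>S\<close> and coefficients \<open>c\<close>. The values of \<open>f\<close> outside the orthant and those of \<open>c\<close> outside
  \<open>S\<close> are irrelevant.\<close>

definition signomial ::
  "(real ^ 'n) set \<Rightarrow> (real ^ 'n \<Rightarrow> real) \<Rightarrow> (real ^ 'n \<Rightarrow> real) \<Rightarrow> bool" where
  "signomial S c f \<longleftrightarrow> finite S \<and> (\<forall>\<mu>\<in>S. c \<mu> \<noteq> 0) \<and>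
     (\<forall>x\<in>pos_orthant. f x = (\<Sum>\<mu>\<in>S. c \<mu> * monomial \<mu> x))"

definition pos_support :: "(real ^ 'n) set \<Rightarrow> (real ^ 'n \<Rightarrow> real) \<Rightarrow> (real ^ 'n) set" where
  "pos_support S c = {\<mu> \<in> S. 0 < c \<mu>}"

definition neg_support :: "(real ^ 'n) set \<Rightarrow> (real ^ 'n \<Rightarrow> real) \<Rightarrow> (real ^ 'n) set" where
  "neg_support S c = {\<mu> \<in> S. c \<mu> < 0}"

definition vertices :: "'a::real_vector set \<Rightarrow> 'a set" where
  "vertices P = {v. v extreme_point_of P}"

text \<open>The vertices \<open>\<mu>\<^sub>0, \<dots>, \<mu>\<^sub>n\<close> of a simplex are not enumerated: barycentric coordinates
  are indexed by the vertices themselves, and \<open>P\<^sup>-\<^sup>,\<^sup>k\<close> is \<open>neg_vertex_cone P v\<close> for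
  \<open>v = \<mu>\<^sub>k\<close>.\<close>

definition neg_vertex_cone :: "'a::real_vector set \<Rightarrow> 'a \<Rightarrow> 'a set" where
  "neg_vertex_cone P v =
     {(\<Sum>u\<in>vertices P. l u *\<^sub>R u) | l.
        (\<Sum>u\<in>vertices P. l u) = 1 \<and> (\<forall>u\<in>vertices P. u \<noteq> v \<longrightarrow> l u \<le> 0)}"

definition neg_cones :: "'a::real_vector set \<Rightarrow> 'a set" where
  "neg_cones P = (\<Union>v\<in>vertices P. neg_vertex_cone P v)"

definition negative_set :: "(real ^ 'n \<Rightarrow> real) \<Rightarrow> (real ^ 'n) set" where
  "negative_set f = {x \<in> pos_orthant. f x < 0}"

definition nonzero_set :: "(real ^ 'n \<Rightarrow> real) \<Rightarrow> (real ^ 'n) set" where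
  "nonzero_set f = {x \<in> pos_orthant. f x \<noteq> 0}"

definition negative_component :: "(real ^ 'n \<Rightarrow> real) \<Rightarrow> (real ^ 'n) set \<Rightarrow> bool" where
  "negative_component f C \<longleftrightarrow> C \<in> components (nonzero_set f) \<and> (\<forall>x\<in>C. f x < 0)"

end

theory Submission imports Defs begin

text \<open>
  Let \<open>\<mu>\<^sub>0, \<dots>, \<mu>\<^sub>n\<close> be the vertices of \<open>P\<close> and put \<open>z\<^sub>k = x\<^bsup>\<mu>\<^sub>k\<^esup>\<close>. A monomial whose exponent has
  barycentric coordinates \<open>\<lambda>\<close> becomes \<open>\<Prod> z\<^sub>k\<^bsup>\<lambda>\<^sub>k\<^esup>\<close>. This is a weighted geometric mean of \<open>z\<close>, hence
  concave, if the exponent lies in \<open>P\<close>; it is convex if the exponent lies in a negative vertex cone,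
  by the reversed inequality of means. So \<open>f\<close> becomes a convex function \<open>F\<close> of \<open>z > 0\<close>,
  homogeneous of degree 1. Since the \<open>(\<mu>\<^sub>k, 1)\<close> form a basis, \<open>x\<close> can be recovered continuously
  from \<open>z\<close> up to a positive factor, which does not affect the sign of \<open>F\<close>. Hence the identity of
  the negative set of \<open>f\<close> factors through the convex set \<open>{F < 0}\<close>.
\<close>

subsection \<open>Weighted geometric means\<close>

definition wgeom :: "'i set \<Rightarrow> ('i \<Rightarrow> real) \<Rightarrow> ('i \<Rightarrow> real) \<Rightarrow> real" where
  "wgeom V l z = (\<Prod>u\<in>V. z u powr l u)"

lemma wgeom_exp:
  assumes "finite V" "\<And>u. u \<in> V \<Longrightarrow> 0 < z u"
  shows "wgeom V l z = exp (\<Sum>u\<in>V. l u * ln (z u))"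
proof -
  have "wgeom V l z = (\<Prod>u\<in>V. exp (l u * ln (z u)))"
    unfolding wgeom_def
    by (intro prod.cong refl) (use assms(2) in \<open>fastforce simp: powr_def\<close>)
  then show ?thesis
    by (simp add: exp_sum assms(1))
qed

lemma wgeom_divide:
  "wgeom V l (\<lambda>u. z u / s u) = wgeom V l z / wgeom V l s"
  unfolding wgeom_def prod_dividef[symmetric]
  by (intro prod.cong refl powr_divide)

lemma wgeom_homogeneous:
  assumes "finite V" "(\<Sum>u\<in>V. l u) = 1" "0 < t" "\<And>u. u \<in> V \<Longrightarrow> 0 < z u"
  shows "wgeom V l (\<lambda>u. t * z u) = t * wgeom V l z"
proof -
  have "(\<Sum>u\<in>V. l u * ln (t * z u)) = ln t + (\<Sum>u\<in>V. l u * ln (z u))"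
  proof -
    have "(\<Sum>u\<in>V. l u * ln (t * z u)) = (\<Sum>u\<in>V. l u * ln t + l u * ln (z u))"
      using assms(3,4) by (intro sum.cong refl) (simp add: ln_mult_pos algebra_simps)
    also have "\<dots> = (\<Sum>u\<in>V. l u) * ln t + (\<Sum>u\<in>V. l u * ln (z u))"
      by (simp add: sum.distrib sum_distrib_right)
    finally show ?thesis using assms(2) by simp
  qed
  then show ?thesis
    using assms by (simp add: wgeom_exp exp_add)
qed

text \<open>Weighted AM-GM: Jensen's inequality for the convex function \<open>exp\<close> at the
  points \<open>ln (z u)\<close>.\<close>

lemma wgeom_le_weighted_sum:
  assumes "finite V" "(\<Sum>u\<in>V. l u) = 1" "\<And>u. u \<in> V \<Longrightarrow> 0 \<le> l u" "\<And>u. u \<in> V \<Longrightarrow> 0 < z u"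
  shows "wgeom V l z \<le> (\<Sum>u\<in>V. l u * z u)"
proof -
  have "V \<noteq> {}" using assms(2) by auto
  then have "exp (\<Sum>u\<in>V. l u *\<^sub>R ln (z u)) \<le> (\<Sum>u\<in>V. l u * exp (ln (z u)))"
    by (intro convex_on_sum[OF _ _ exp_convex]) (use assms in auto)
  then show ?thesis
    using assms by (simp add: wgeom_exp)
qed

text \<open>The inequality of means reverses when no weight except that of \<open>k\<close> is
  positive: it is the ordinary inequality with the roles of \<open>z k\<close> and the mean
  \<open>T\<close> exchanged.\<close>

lemma weighted_sum_le_wgeom:
  assumes V: "finite V" "k \<in> V" and l: "(\<Sum>u\<in>V. l u) = 1" "\<And>u. u \<in> V \<Longrightarrow> u \<noteq> k \<Longrightarrow> l u \<le> 0"
    and z: "\<And>u. u \<in> V \<Longrightarrow> 0 < z u"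
  shows "(\<Sum>u\<in>V. l u * z u) \<le> wgeom V l z"
proof -
  define T where "T = wgeom V l z"
  \<comment> \<open>Solving \<open>T = \<Prod> z\<^sub>u\<^bsup>l\<^sub>u\<^esup>\<close> for \<open>z\<^sub>k\<close> exhibits \<open>z\<^sub>k\<close> as a mean with the nonnegative weights \<open>m\<close>.\<close>
  define m where "m u = (if u = k then 1 / l k else - l u / l k)" for u
  define w where "w u = (if u = k then T else z u)" for u
  have split: "(\<Sum>u\<in>V. g u) = g k + (\<Sum>u\<in>V-{k}. g u)" for g :: "_ \<Rightarrow> real"
    using V by (rule sum.remove)
  have T: "T = exp (\<Sum>u\<in>V. l u * ln (z u))" unfolding T_def using V(1) z by (rule wgeom_exp)
  \<comment> \<open>The other weights sum to at most 0, so \<open>l k\<close> is at least 1. This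
    permits division by \<open>l k\<close> and makes \<open>m\<close> nonnegative on
    \<open>V\<close>.\<close>
  have "(\<Sum>u\<in>V-{k}. l u) \<le> 0" using l(2) by (intro sum_nonpos) auto
  with l(1) have k: "1 \<le> l k" "(\<Sum>u\<in>V-{k}. l u) = 1 - l k" by (auto simp: split)
  have m: "(\<Sum>u\<in>V. m u * g u) = (g k - (\<Sum>u\<in>V-{k}. l u * g u)) / l k" for g
  proof -
    have "(\<Sum>u\<in>V-{k}. m u * g u) = (\<Sum>u\<in>V-{k}. - (l u * g u) / l k)"
      by (intro sum.cong) (auto simp: m_def)
    then show ?thesis
      by (subst split) (simp add: m_def sum_divide_distrib[symmetric] sum_negf diff_divide_distrib)
  qed
  have w: "(\<Sum>u\<in>V-{k}. l u * h (w u)) = (\<Sum>u\<in>V-{k}. l u * h (z u))" for h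
    by (intro sum.cong) (auto simp: w_def)
  have w_pos: "0 < w u" if "u \<in> V" for u using that z by (simp add: w_def T)
  have "wgeom V m w \<le> (\<Sum>u\<in>V. m u * w u)"
  proof (rule wgeom_le_weighted_sum)
    show "(\<Sum>u\<in>V. m u) = 1" using m[of "\<lambda>_. 1"] k by simp
  qed (use V l k w_pos in \<open>auto simp: m_def divide_nonpos_pos\<close>)
  also have "wgeom V m w = exp (\<Sum>u\<in>V. m u * ln (w u))"
    using V(1) w_pos by (rule wgeom_exp)
  \<comment> \<open>Expanding \<open>ln T\<close> cancels all terms except
    \<open>l k * ln (z k)\<close>, which is then divided by \<open>l k\<close>.\<close>
  also have "(\<Sum>u\<in>V. m u * ln (w u)) = ln (z k)"
    using k by (simp add: m w[of ln] w_def[of k] T split[of "\<lambda>u. l u * ln (z u)"])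
  also have "(\<Sum>u\<in>V. m u * w u) = (T - (\<Sum>u\<in>V-{k}. l u * z u)) / l k"
    using w[of "\<lambda>x. x"] by (simp add: m w_def[of k])
  finally have "l k * z k \<le> T - (\<Sum>u\<in>V-{k}. l u * z u)"
    using k z[OF V(2)] by (simp add: field_simps)
  then show ?thesis by (simp add: split T_def)
qed

text \<open>The hypothesis says that the graph of \<open>c * wgeom V l\<close> lies above its tangent plane at
  \<open>(1, \<dots>, 1)\<close>; by multiplicativity the same then holds at every point.\<close>

lemma wgeom_convex:
  assumes V: "finite V" "(\<Sum>u\<in>V. l u) = 1"
    and tangent: "\<And>z. (\<And>u. u \<in> V \<Longrightarrow> 0 < z u) \<Longrightarrow> c * (\<Sum>u\<in>V. l u * z u) \<le> c * wgeom V l z"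
    and z: "\<And>u. u \<in> V \<Longrightarrow> 0 < z u" and w: "\<And>u. u \<in> V \<Longrightarrow> 0 < w u"
    and t: "0 < t" "t < 1"
  shows "c * wgeom V l (\<lambda>u. (1 - t) * z u + t * w u)
         \<le> (1 - t) * (c * wgeom V l z) + t * (c * wgeom V l w)"
proof -
  \<comment> \<open>Dividing by the intermediate point \<open>s\<close> moves it to (1, ..., 1). The
    inequality \<open>tangent\<close> is then used at \<open>z / s\<close> and \<open>w / s\<close>,
    whose convex combination with parameter \<open>t\<close> is 1 in every coordinate.\<close>
  define s where "s u = (1 - t) * z u + t * w u" for u
  have s: "0 < s u" if "u \<in> V" for u
    unfolding s_def using z[OF that] w[OF that] t by (simp add: add_pos_pos)
  have G: "0 < wgeom V l s" using V(1) s by (simp add: wgeom_exp)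
  have "(1 - t) * (\<Sum>u\<in>V. l u * (z u / s u)) + t * (\<Sum>u\<in>V. l u * (w u / s u))
        = (\<Sum>u\<in>V. l u * (((1 - t) * z u + t * w u) / s u))"
    by (simp add: sum_distrib_left sum.distrib[symmetric] add_divide_distrib diff_divide_distrib algebra_simps)
  also have "\<dots> = (\<Sum>u\<in>V. l u)"
    using s by (intro sum.cong refl) (fastforce simp: s_def)
  finally have "c = (1 - t) * (c * (\<Sum>u\<in>V. l u * (z u / s u))) + t * (c * (\<Sum>u\<in>V. l u * (w u / s u)))"
    using V(2) by (metis (no_types, lifting) distrib_left mult.left_commute mult.right_neutral)
  also have "\<dots> \<le> (1 - t) * (c * wgeom V l (\<lambda>u. z u / s u)) + t * (c * wgeom V l (\<lambda>u. w u / s u))"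
    using t z w s by (intro add_mono mult_left_mono tangent) auto
  also have "\<dots> = ((1 - t) * (c * wgeom V l z) + t * (c * wgeom V l w)) / wgeom V l s"
    using z w s by (simp add: wgeom_divide add_divide_distrib)
  finally show ?thesis
    using G by (simp add: pos_le_divide_eq s_def[abs_def])
qed

subsection \<open>Logarithmic coordinates\<close>

definition vec_ln :: "real ^ 'n \<Rightarrow> real ^ 'n" where
  "vec_ln x = (\<chi> i. ln (x $ i))"

definition vec_exp :: "real ^ 'n \<Rightarrow> real ^ 'n" where
  "vec_exp y = (\<chi> i. exp (y $ i))"

lemma vec_exp_pos: "vec_exp y \<in> pos_orthant"
  by (simp add: vec_exp_def pos_orthant_def)

lemma vec_ln_exp [simp]: "vec_ln (vec_exp y) = y"
  by (simp add: vec_ln_def vec_exp_def vec_eq_iff)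

lemma vec_exp_ln [simp]: "x \<in> pos_orthant \<Longrightarrow> vec_exp (vec_ln x) = x"
  by (simp add: vec_ln_def vec_exp_def vec_eq_iff pos_orthant_def)

lemma continuous_on_vec_ln: "continuous_on pos_orthant vec_ln"
  unfolding vec_ln_def
  by (intro continuous_on_vec_lambda continuous_intros)
    (auto simp: pos_orthant_def less_imp_neq[symmetric])

lemma continuous_on_vec_exp: "continuous_on A vec_exp"
  unfolding vec_exp_def by (intro continuous_on_vec_lambda continuous_intros)

lemma monomial_exp:
  assumes "x \<in> pos_orthant"
  shows "monomial \<mu> x = exp (\<mu> \<bullet> vec_ln x)"
proof -
  have "monomial \<mu> x = (\<Prod>i\<in>UNIV. exp (\<mu> $ i * ln (x $ i)))"
    unfolding monomial_def using assms
    by (intro prod.cong refl) (auto simp: pos_orthant_def powr_def less_imp_neq[symmetric])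
  then show ?thesis by (simp add: exp_sum inner_vec_def vec_ln_def)
qed

lemma monomial_combination:
  assumes "x \<in> pos_orthant" "finite V"
  shows "monomial (\<Sum>u\<in>V. l u *\<^sub>R u) x = wgeom V l (\<lambda>u. monomial u x)"
  using assms by (simp add: wgeom_exp monomial_exp inner_sum_left)

subsection \<open>Dual bases\<close>

lemma dual_basis_exists:
  fixes b :: "'i \<Rightarrow> 'a::euclidean_space"
  assumes "inj_on b V" "independent (b ` V)"
  shows "\<exists>q. \<forall>v\<in>V. \<forall>u\<in>V. q v \<bullet> b u = (if u = v then 1 else 0)"
proof -
  have "\<exists>q. \<forall>u\<in>V. q \<bullet> b u = (if u = v then 1 else 0)" for v
  proof -
    \<comment> \<open>Injectivity of \<open>b\<close> on \<open>V\<close> lets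
      \<open>inv_into\<close> recover the index of a basis vector.\<close>
    define \<delta> where "\<delta> a = (if inv_into V b a = v then 1 else 0 :: real)" for a
    from linear_independent_extend[OF assms(2)]
    obtain g where g: "linear g" "\<forall>a\<in>b ` V. g a = \<delta> a" by blast
    have "adjoint g 1 \<bullet> b u = (if u = v then 1 else 0)" if "u \<in> V" for u
      using that g adjoint_works[OF g(1), of "b u" 1] assms(1)
      by (simp add: \<delta>_def inner_commute)
    then show ?thesis by blast
  qed
  then show ?thesis by metis
qed

text \<open>In a linear relation between points lifted to height 1, the last coordinate says that
  the coefficients sum to 0, so the relation is an affine one.\<close>

lemma independent_homogenization:
  assumes "\<not> affine_dependent V"
  shows "independent ((\<lambda>u. (u, 1 :: real)) ` (V :: 'a::euclidean_space set))"
proof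
  have V: "finite V" using assms by (rule aff_independent_finite)
  have inj: "inj_on (\<lambda>u. (u, 1 :: real)) V" by (simp add: inj_on_def)
  assume "dependent ((\<lambda>u. (u, 1 :: real)) ` V)"
  then obtain g where "\<exists>v\<in>(\<lambda>u. (u, 1 :: real)) ` V. g v \<noteq> 0"
    "(\<Sum>v\<in>(\<lambda>u. (u, 1 :: real)) ` V. g v *\<^sub>R v) = 0"
    using V unfolding dependent_finite[OF finite_imageI[OF V]] by blast
  then have g: "\<exists>v\<in>V. g (v, 1) \<noteq> 0" "(\<Sum>u\<in>V. g (u, 1) *\<^sub>R (u, 1 :: real)) = 0"
    by (simp_all add: sum.reindex[OF inj] o_def del: scaleR_Pair)
  have "(\<Sum>u\<in>V. g (u, 1)) = 0" "(\<Sum>u\<in>V. g (u, 1) *\<^sub>R u) = 0"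
    using g(2) by (simp_all add: prod_eq_iff fst_sum snd_sum)
  with g(1) have "affine_dependent V"
    unfolding affine_dependent_explicit_finite[OF V] by (intro exI[of _ "\<lambda>u. g (u, 1)"]) auto
  with assms show False by simp
qed

subsection \<open>The negative set\<close>

text \<open>The hypothesis \<open>tangent\<close> is the common form of both inequalities of means,
  so exponents in the simplex and in the negative cones are treated alike.\<close>

lemma negative_set_contractible:
  fixes V :: "(real ^ 'n) set"
  assumes V: "\<not> affine_dependent V" "card V = CARD('n) + 1"
    and S: "finite S" "\<And>\<mu>. \<mu> \<in> S \<Longrightarrow> \<mu> = (\<Sum>u\<in>V. l \<mu> u *\<^sub>R u)" "\<And>\<mu>. \<mu> \<in> S \<Longrightarrow> (\<Sum>u\<in>V. l \<mu> u) = 1"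
    and tangent: "\<And>\<mu> z. \<mu> \<in> S \<Longrightarrow> (\<And>u. u \<in> V \<Longrightarrow> 0 < z u) \<Longrightarrow>
      c \<mu> * (\<Sum>u\<in>V. l \<mu> u * z u) \<le> c \<mu> * wgeom V (l \<mu>) z"
    and f: "\<And>x. x \<in> pos_orthant \<Longrightarrow> f x = (\<Sum>\<mu>\<in>S. c \<mu> * monomial \<mu> x)"
  shows "contractible (negative_set f)"
proof -
  have finV: "finite V" using V(1) by (rule aff_independent_finite)
  define b where "b u = (u, 1 :: real)" for u :: "real ^ 'n"
  have inj: "inj_on b V" by (simp add: b_def inj_on_def)
  have indep: "independent (b ` V)"
    using independent_homogenization[OF V(1)] by (simp add: b_def[abs_def])
  \<comment> \<open>The pairs form a space of dimension n + 1, the number of vertices, so the lifted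
    vertices span it.\<close>
  have "UNIV \<subseteq> span (b ` V)"
    using indep by (intro card_ge_dim_independent) (simp_all add: card_image[OF inj] V(2))
  then have ext: "a = a'" if "\<And>u. u \<in> V \<Longrightarrow> a \<bullet> b u = a' \<bullet> b u" for a a'
  proof -
    have "a \<bullet> x = a' \<bullet> x" for x
    proof (rule linear_eq_on[of "(\<bullet>) a" "(\<bullet>) a'" x "b ` V"])
      show "linear ((\<bullet>) a)" "linear ((\<bullet>) a')"
        by (intro bounded_linear.linear bounded_linear_inner_right)+
      show "x \<in> span (b ` V)" using \<open>UNIV \<subseteq> span (b ` V)\<close> by blast
    qed (use that in blast)
    then show ?thesis using vector_eq_rdot by blast
  qed
  obtain q where q: "\<And>v u. v \<in> V \<Longrightarrow> u \<in> V \<Longrightarrow> q v \<bullet> b u = (if u = v then 1 else 0)"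
    using dual_basis_exists[OF inj indep] by blast
  have q_sum: "(\<Sum>v\<in>V. g v *\<^sub>R q v) \<bullet> b u = g u" if "u \<in> V" for g u
    using that finV by (simp add: inner_sum_left q if_distrib[of "(*) _"] cong: if_cong)
  define F where "F z = (\<Sum>\<mu>\<in>S. c \<mu> * wgeom V (l \<mu>) z)" for z
  have F_monomial: "f x = F (\<lambda>u. monomial u x)" if "x \<in> pos_orthant" for x
  proof -
    have "monomial \<mu> x = wgeom V (l \<mu>) (\<lambda>u. monomial u x)" if "\<mu> \<in> S" for \<mu>
      using monomial_combination[OF \<open>x \<in> pos_orthant\<close> finV, of "l \<mu>"]
      unfolding S(2)[OF that, symmetric] .
    then show ?thesis by (simp add: f[OF that] F_def)
  qed
  have F_cong: "F z = F w" if "\<And>u. u \<in> V \<Longrightarrow> z u = w u" for z w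
    using that by (simp add: F_def wgeom_def cong: prod.cong)
  \<comment> \<open>The convex set \<open>{F < 0}\<close>, realized in a Euclidean space: a vector
    \<open>a\<close> encodes the point \<open>z\<close> with
    \<open>z u = a \<bullet> b u\<close>.\<close>
  define K where "K = {a. (\<forall>u\<in>V. 0 < a \<bullet> b u) \<and> F (\<lambda>u. a \<bullet> b u) < 0}"
  have "convex K"
    unfolding convex_alt
  proof safe
    fix x y t assume xy: "x \<in> K" "y \<in> K" and "0 \<le> (t :: real)" "t \<le> 1"
    show "(1 - t) *\<^sub>R x + t *\<^sub>R y \<in> K"
    proof (cases "0 < t \<and> t < 1")
      case True
      have pos: "0 < x \<bullet> b u" "0 < y \<bullet> b u" if "u \<in> V" for u using xy that by (auto simp: K_def)
      have "F (\<lambda>u. (1 - t) * (x \<bullet> b u) + t * (y \<bullet> b u))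
            \<le> (\<Sum>\<mu>\<in>S. (1 - t) * (c \<mu> * wgeom V (l \<mu>) (\<lambda>u. x \<bullet> b u)) + t * (c \<mu> * wgeom V (l \<mu>) (\<lambda>u. y \<bullet> b u)))"
        unfolding F_def by (intro sum_mono wgeom_convex finV S(3) tangent pos) (use True in auto)
      also have "\<dots> = (1 - t) * F (\<lambda>u. x \<bullet> b u) + t * F (\<lambda>u. y \<bullet> b u)"
        by (simp add: F_def sum.distrib sum_distrib_left)
      also have "\<dots> < 0"
        using xy True by (intro add_neg_neg mult_pos_neg) (auto simp: K_def)
      finally show ?thesis
        using pos True by (simp add: K_def inner_add_left add_pos_pos)
    qed (use xy \<open>0 \<le> t\<close> \<open>t \<le> 1\<close> in \<open>auto simp: not_less\<close>)
  qed
  define \<phi> where "\<phi> x = (\<Sum>v\<in>V. monomial v x *\<^sub>R q v)" for x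
  \<comment> \<open>\<open>L a\<close> is the pair (y, s) that solves
    \<open>ln (a \<bullet> b u) = u \<bullet> y + s\<close> for all vertices \<open>u\<close>. The
    map \<open>\<psi>\<close> keeps exp(y) and drops the positive factor exp(s).\<close>
  define L where "L a = (\<Sum>v\<in>V. ln (a \<bullet> b v) *\<^sub>R q v)" for a
  define \<psi> where "\<psi> a = vec_exp (fst (L a))" for a
  have \<phi>: "\<phi> x \<bullet> b u = monomial u x" if "u \<in> V" for x u
    unfolding \<phi>_def by (rule q_sum[OF that])
  have \<psi>_monomial: "monomial u (\<psi> a) = exp (- snd (L a)) * (a \<bullet> b u)" if "u \<in> V" "a \<in> K" for u a
  proof -
    have "L a \<bullet> b u = ln (a \<bullet> b u)" unfolding L_def by (rule q_sum[OF that(1)])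
    moreover have "L a \<bullet> b u = u \<bullet> fst (L a) + snd (L a)"
      by (simp add: b_def inner_prod_def inner_commute)
    ultimately have "u \<bullet> fst (L a) = - snd (L a) + ln (a \<bullet> b u)" by simp
    then have "exp (u \<bullet> fst (L a)) = exp (- snd (L a)) * exp (ln (a \<bullet> b u))"
      by (simp only: exp_add)
    with that show ?thesis
      by (simp add: monomial_exp \<psi>_def vec_exp_pos K_def)
  qed
  have \<phi>_cont: "continuous_on (negative_set f) \<phi>"
  proof -
    have "continuous_on (negative_set f) (\<lambda>x. \<Sum>v\<in>V. exp (v \<bullet> vec_ln x) *\<^sub>R q v)"
      by (intro continuous_intros continuous_on_subset[OF continuous_on_vec_ln])
        (auto simp: negative_set_def)
    then show ?thesis
      by (rule continuous_on_eq) (auto simp: \<phi>_def monomial_exp negative_set_def)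
  qed
  have \<phi>_K: "\<phi> \<in> negative_set f \<rightarrow> K"
  proof
    fix x assume "x \<in> negative_set f"
    then have x: "x \<in> pos_orthant" "f x < 0" by (auto simp: negative_set_def)
    have "F (\<lambda>u. \<phi> x \<bullet> b u) = f x"
      unfolding F_monomial[OF x(1)] by (rule F_cong) (rule \<phi>)
    then show "\<phi> x \<in> K" using x by (simp add: K_def \<phi> monomial_exp)
  qed
  have \<psi>_cont: "continuous_on K \<psi>"
    unfolding \<psi>_def L_def
    by (intro continuous_on_compose2[OF continuous_on_vec_exp[of UNIV]] continuous_intros)
      (auto simp: K_def)
  have \<psi>_neg: "\<psi> \<in> K \<rightarrow> negative_set f"
  proof
    fix a assume a: "a \<in> K"
    let ?t = "exp (- snd (L a))"
    have x: "\<psi> a \<in> pos_orthant" by (simp add: \<psi>_def vec_exp_pos)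
    have "f (\<psi> a) = F (\<lambda>u. ?t * (a \<bullet> b u))"
      unfolding F_monomial[OF x] by (rule F_cong) (rule \<psi>_monomial[OF _ a])
    also have "\<dots> = ?t * F (\<lambda>u. a \<bullet> b u)"
      unfolding F_def sum_distrib_left
    proof (intro sum.cong refl)
      fix \<mu> assume "\<mu> \<in> S"
      then have "wgeom V (l \<mu>) (\<lambda>u. ?t * (a \<bullet> b u)) = ?t * wgeom V (l \<mu>) (\<lambda>u. a \<bullet> b u)"
        using a by (intro wgeom_homogeneous finV S(3)) (auto simp: K_def)
      then show "c \<mu> * wgeom V (l \<mu>) (\<lambda>u. ?t * (a \<bullet> b u)) = ?t * (c \<mu> * wgeom V (l \<mu>) (\<lambda>u. a \<bullet> b u))"
        by simp
    qed
    also have "\<dots> < 0" using a by (intro mult_pos_neg) (auto simp: K_def)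
    finally show "\<psi> a \<in> negative_set f" using x by (simp add: negative_set_def)
  qed
  have \<psi>_\<phi>: "\<psi> (\<phi> x) = x" if "x \<in> negative_set f" for x
  proof -
    have x: "x \<in> pos_orthant" using that by (simp add: negative_set_def)
    \<comment> \<open>On the image of \<open>\<phi>\<close> the dropped factor is 1, so nothing is
      lost.\<close>
    have "L (\<phi> x) = (vec_ln x, 0)"
    proof (rule ext)
      fix u assume "u \<in> V"
      then have "L (\<phi> x) \<bullet> b u = u \<bullet> vec_ln x"
        using x by (simp add: L_def q_sum \<phi> monomial_exp)
      then show "L (\<phi> x) \<bullet> b u = (vec_ln x, 0) \<bullet> b u"
        by (simp add: b_def inner_prod_def inner_commute)
    qed
    then show ?thesis using x by (simp add: \<psi>_def)
  qed
  \<comment> \<open>A map that factors through the contractible \<open>K\<close> is null-homotopic,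
    and \<open>\<psi> \<circ> \<phi>\<close> is the identity on the negative set. As
    \<open>contractible\<close> admits the empty set, the empty case is included.\<close>
  obtain e where "homotopic_with_canon (\<lambda>h. True) (negative_set f) (negative_set f) (\<psi> \<circ> \<phi>) (\<lambda>x. e)"
    using nullhomotopic_through_contractible[OF \<phi>_cont \<phi>_K \<psi>_cont \<psi>_neg
        convex_imp_contractible[OF \<open>convex K\<close>]] .
  then have "homotopic_with_canon (\<lambda>h. True) (negative_set f) (negative_set f) id (\<lambda>x. e)"
    by (rule homotopic_with_eq) (simp_all add: \<psi>_\<phi>)
  then show ?thesis unfolding contractible_def by blast
qed

text \<open>A negative component meets the negative set, which is a connected part of the nonzero
  set, so maximality of components makes it absorb that set.\<close>

lemma negative_component_eq:
  assumes "connected (negative_set f)" "negative_component f C"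
  shows "C = negative_set f"
proof
  have C: "C \<in> components (nonzero_set f)" and neg: "\<And>x. x \<in> C \<Longrightarrow> f x < 0"
    using assms(2) by (auto simp: negative_component_def)
  have "C \<subseteq> nonzero_set f" "C \<noteq> {}" using C by (rule in_components_subset in_components_nonempty)+
  then show "C \<subseteq> negative_set f" using neg by (auto simp: nonzero_set_def negative_set_def)
  with \<open>C \<noteq> {}\<close> show "negative_set f \<subseteq> C"
    by (intro components_maximal[OF C assms(1)]) (auto simp: nonzero_set_def negative_set_def)
qed

theorem theorem4p6:
  fixes f :: "real ^ 'n \<Rightarrow> real"
    and S :: "(real ^ 'n) set"
    and c :: "real ^ 'n \<Rightarrow> real"
  assumes "signomial S c f"
    and "\<exists>P :: (real ^ 'n) set. int CARD('n) simplex P \<and>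
           neg_support S c \<subseteq> P \<and> pos_support S c \<subseteq> neg_cones P"
  shows "(negative_set f = {} \<or> contractible (negative_set f)) \<and>
         (\<exists>\<^sub>\<le>\<^sub>1 C. negative_component f C)"
proof -
  from assms(2) obtain P V where P: "neg_support S c \<subseteq> P" "pos_support S c \<subseteq> neg_cones P"
    and V: "\<not> affine_dependent V" "int (card V) = int CARD('n) + 1" "P = convex hull V"
    unfolding simplex_def by blast
  have finV: "finite V" using V(1) by (rule aff_independent_finite)
  have verts: "vertices P = V"
    using extreme_point_of_convex_hull_affine_independent[OF V(1)] by (auto simp: vertices_def V(3))
  have S: "finite S" "\<And>\<mu>. \<mu> \<in> S \<Longrightarrow> c \<mu> \<noteq> 0"
    and f: "\<And>x. x \<in> pos_orthant \<Longrightarrow> f x = (\<Sum>\<mu>\<in>S. c \<mu> * monomial \<mu> x)"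
    using assms(1) by (auto simp: signomial_def)
  have "\<exists>l. \<mu> = (\<Sum>u\<in>V. l u *\<^sub>R u) \<and> (\<Sum>u\<in>V. l u) = 1 \<and>
      (\<forall>z. (\<forall>u\<in>V. 0 < z u) \<longrightarrow> c \<mu> * (\<Sum>u\<in>V. l u * z u) \<le> c \<mu> * wgeom V l z)" if "\<mu> \<in> S" for \<mu>
  proof (cases "c \<mu> < 0")
    case True
    then have "\<mu> \<in> convex hull V" using that P(1) by (auto simp: neg_support_def V(3))
    then obtain l where "\<forall>u\<in>V. 0 \<le> l u" "(\<Sum>u\<in>V. l u) = 1" "\<mu> = (\<Sum>u\<in>V. l u *\<^sub>R u)"
      by (auto simp: convex_hull_finite[OF finV])
    \<comment> \<open>Multiplying AM-GM by the negative coefficient turns it into the required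
      direction.\<close>
    with True show ?thesis
      by (intro exI[of _ l]) (auto intro!: mult_left_mono_neg wgeom_le_weighted_sum finV)
  next
    case False
    then have "0 < c \<mu>" using S(2)[OF that] by simp
    then have "\<mu> \<in> neg_cones P" using that P(2) by (auto simp: pos_support_def)
    then obtain k l where "k \<in> V" "\<forall>u\<in>V. u \<noteq> k \<longrightarrow> l u \<le> 0" "(\<Sum>u\<in>V. l u) = 1"
      "\<mu> = (\<Sum>u\<in>V. l u *\<^sub>R u)"
      by (auto simp: neg_cones_def neg_vertex_cone_def verts)
    with \<open>0 < c \<mu>\<close> show ?thesis
      by (intro exI[of _ l]) (auto intro!: mult_left_mono weighted_sum_le_wgeom[of V k] finV)
  qed
  then have "\<exists>l. \<forall>\<mu>\<in>S. \<mu> = (\<Sum>u\<in>V. l \<mu> u *\<^sub>R u) \<and> (\<Sum>u\<in>V. l \<mu> u) = 1 \<and>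
      (\<forall>z. (\<forall>u\<in>V. 0 < z u) \<longrightarrow>
        c \<mu> * (\<Sum>u\<in>V. l \<mu> u * z u) \<le> c \<mu> * wgeom V (l \<mu>) z)"
    by (intro bchoice) blast
  then obtain l where "\<forall>\<mu>\<in>S. \<mu> = (\<Sum>u\<in>V. l \<mu> u *\<^sub>R u) \<and> (\<Sum>u\<in>V. l \<mu> u) = 1 \<and>
      (\<forall>z. (\<forall>u\<in>V. 0 < z u) \<longrightarrow>
        c \<mu> * (\<Sum>u\<in>V. l \<mu> u * z u) \<le> c \<mu> * wgeom V (l \<mu>) z)" ..
  then have l: "\<And>\<mu>. \<mu> \<in> S \<Longrightarrow> \<mu> = (\<Sum>u\<in>V. l \<mu> u *\<^sub>R u)"
    "\<And>\<mu>. \<mu> \<in> S \<Longrightarrow> (\<Sum>u\<in>V. l \<mu> u) = 1"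
    "\<And>\<mu> z. \<mu> \<in> S \<Longrightarrow> (\<And>u. u \<in> V \<Longrightarrow> 0 < z u) \<Longrightarrow>
      c \<mu> * (\<Sum>u\<in>V. l \<mu> u * z u) \<le> c \<mu> * wgeom V (l \<mu>) z"
    by blast+
  have contr: "contractible (negative_set f)"
    using V(2) by (intro negative_set_contractible[OF V(1) _ S(1) l f]) auto
  then have "connected (negative_set f)" by (rule contractible_imp_connected)
  then have "\<exists>\<^sub>\<le>\<^sub>1 C. negative_component f C"
    unfolding Uniq_def by (metis negative_component_eq)
  with contr show ?thesis by blast
qed

end
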